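(* Let $i\in\{1,2\}$, $\varepsilon=(-1)^i$, let $\lambda_1,\lambda_2,\lambda_3,\lambda_4\in\mathbb{R}$ be not all zero, put $\delta=\lambda_1+\lambda_2+\lambda_3-\lambda_4$, and equip $\mathbb{E}_1^4$ with the density $e^{\lambda_1x^2+\lambda_2y^2+\lambda_3z^2+\lambda_4t^2}$. Suppose that $f(u)=u$. Then the timelike general rotational surfaces of first and second types $\mathcal{S}_i$ are weighted flat if and only if, up to parametrization, the meridian curves are determined by $c_1:x_1(u)=(u,0,g(u),0)$ (for $\mathcal{S}_1$) and $c_2:x_2(u)=(u,0,0,g(u))$ (for $\mathcal{S}_2$), where $g(u)$ is a solution to the following differential equations: for $\mathcal{S}_1$ $$\left(\arctan\left(g'(u)\right)\right)'=A_3$$ and for $\mathcal{S}_2$ $$\left(\log\left(\frac{1-g'(u)}{1+g'(u)}\right)\right)'=2A_3,$$ where $$A_3=\frac{-2\delta\left((\alpha u)^2+\varepsilon(\beta g(u))^2\right)^2\left(-\varepsilon+g'(u)^2\right)+\alpha^2\beta^2\left(g(u)-ug'(u)\right)^2}{\left(\varepsilon(\alpha u)^2+(\beta g(u))^2\right)\left(\beta^2g(u)+\alpha^2ug'(u)\right)}.$$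
   Context: $\mathbb{E}_1^4$ is $\mathbb{R}^4$ with coordinates $(x,y,z,t)$ and the metric $dx^2+dy^2+dz^2-dt^2$. Let $\alpha,\beta>0$ be constants, $J\subset\mathbb{R}$, $f,g:J\to\mathbb{R}$ smooth functions of $u$ (primes denote $d/du$), and $v\in[0,2\pi)$. First type: $\mathcal{S}_1: X_1(u,v)=(f\cos(\alpha v),f\sin(\alpha v),g\cosh(\beta v),g\sinh(\beta v))$ with $\alpha^2f^2-\beta^2g^2<0$ and $f'^2+g'^2>0$ on $J$; its meridian curve is $u\mapsto(f(u),0,g(u),0)$. Second type: $\mathcal{S}_2: X_2(u,v)=(f\cos(\alpha v),f\sin(\alpha v),g\sinh(\beta v),g\cosh(\beta v))$ with $f'^2-g'^2<0$ and $\alpha^2f^2+\beta^2g^2>0$ on $J$; its meridian curve is $u\mapsto(f(u),0,0,g(u))$. Both surfaces are timelike. With $\varepsilon=(-1)^i$, the Gaussian curvature of $\mathcal{S}_i$ is $$K^{\mathcal{S}_i}=\frac{\alpha^2\beta^2(gf'-fg')^2(-\varepsilon f'^2+g'^2)+\left(\varepsilon(\alpha f)^2+(\beta g)^2\right)(\alpha^2fg'+\beta^2gf')(f''g'-f'g'')}{\left((\alpha f)^2+\varepsilon(\beta g)^2\right)^2(-\varepsilon f'^2+g'^2)^2}.$$ For a density $e^\phi$ on $\mathbb{E}_1^4$, the weighted Gaussian curvature is $K_\phi^{\mathcal{S}_i}=K^{\mathcal{S}_i}-\Delta\phi$, where $\Delta$ is the Laplacian of $\mathbb{E}_1^4$,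 $\Delta\phi=\phi_{xx}+\phi_{yy}+\phi_{zz}-\phi_{tt}$; for the density above $\Delta\phi=2\delta$. The surface is weighted flat if $K_\phi^{\mathcal{S}_i}$ vanishes.
   Formalization: For the second type g'^2>1 makes (1-g')/(1+g') negative, so the logarithm is taken of its absolute value; and β²g+α²ug' is assumed nonzero on J, since otherwise A_3 is undefined. *)

theory Defs
  imports "HOL-Analysis.Analysis"
begin

section \<open>Minkowski 4-space\<close>

definition mink :: "real ^ 4 \<Rightarrow> real ^ 4 \<Rightarrow> real" where
  "mink p q = p $ 1 * q $ 1 + p $ 2 * q $ 2 + p $ 3 * q $ 3 - p $ 4 * q $ 4"

definition partial :: "4 \<Rightarrow> (real ^ 4 \<Rightarrow> real) \<Rightarrow> real ^ 4 \<Rightarrow> real" where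
  "partial k \<phi> p = deriv (\<lambda>s. \<phi> (p + s *\<^sub>R axis k 1)) 0"

definition mink_laplacian :: "(real ^ 4 \<Rightarrow> real) \<Rightarrow> real ^ 4 \<Rightarrow> real" where
  "mink_laplacian \<phi> p =
     partial 1 (partial 1 \<phi>) p + partial 2 (partial 2 \<phi>) p
     + partial 3 (partial 3 \<phi>) p - partial 4 (partial 4 \<phi>) p"


section \<open>Surfaces, Gaussian curvature and weighted Gaussian curvature\<close>

definition surf_du :: "(real \<Rightarrow> real \<Rightarrow> real ^ 4) \<Rightarrow> real \<Rightarrow> real \<Rightarrow> real ^ 4" where
  "surf_du X u v = vector_derivative (\<lambda>s. X s v) (at u)"

definition surf_dv :: "(real \<Rightarrow> real \<Rightarrow> real ^ 4) \<Rightarrow> real \<Rightarrow> real \<Rightarrow> real ^ 4" where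
  "surf_dv X u v = vector_derivative (\<lambda>s. X u s) (at v)"

definition gram_det :: "real ^ 4 \<Rightarrow> real ^ 4 \<Rightarrow> real" where
  "gram_det p q = mink p p * mink q q - (mink p q)\<^sup>2"

text \<open>The component of \<open>a\<close> that is Minkowski-orthogonal to the nondegenerate plane
  spanned by \<open>p\<close> and \<open>q\<close>; the subtracted coefficients solve the normal equations
  by Cramer's rule.\<close>

definition normal_part :: "real ^ 4 \<Rightarrow> real ^ 4 \<Rightarrow> real ^ 4 \<Rightarrow> real ^ 4" where
  "normal_part p q a = a
     - ((mink q q * mink a p - mink p q * mink a q) / gram_det p q) *\<^sub>R p
     - ((mink p p * mink a q - mink p q * mink a p) / gram_det p q) *\<^sub>R q"

text \<open>Gauss equation in a flat ambient space: the curvature is the determinant of the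
  normal-space-valued second fundamental form divided by that of the first. For the
  surfaces below, lemma \<open>gaussian_curvature_gen_rot\<close> gives the closed formula.\<close>

definition gaussian_curvature :: "(real \<Rightarrow> real \<Rightarrow> real ^ 4) \<Rightarrow> real \<Rightarrow> real \<Rightarrow> real" where
  "gaussian_curvature X u v =
     (let p = surf_du X u v; q = surf_dv X u v;
          h11 = normal_part p q (surf_du (surf_du X) u v);
          h12 = normal_part p q (surf_dv (surf_du X) u v);
          h22 = normal_part p q (surf_dv (surf_dv X) u v)
      in (mink h11 h22 - mink h12 h12) / gram_det p q)"

text \<open>The function \<open>\<phi>\<close> is the exponent of the density \<open>exp \<circ> \<phi>\<close>.\<close>

definition weighted_gaussian_curvature ::
    "(real ^ 4 \<Rightarrow> real) \<Rightarrow> (real \<Rightarrow> real \<Rightarrow> real ^ 4) \<Rightarrow> real \<Rightarrow> real \<Rightarrow> real" where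
  "weighted_gaussian_curvature \<phi> X u v =
     gaussian_curvature X u v - mink_laplacian \<phi> (X u v)"

definition weighted_flat ::
    "(real ^ 4 \<Rightarrow> real) \<Rightarrow> (real \<Rightarrow> real \<Rightarrow> real ^ 4) \<Rightarrow> real set \<Rightarrow> bool" where
  "weighted_flat \<phi> X J \<longleftrightarrow>
     (\<forall>u\<in>J. \<forall>v\<in>{0..<2 * pi}. weighted_gaussian_curvature \<phi> X u v = 0)"

definition quad_exponent :: "real \<Rightarrow> real \<Rightarrow> real \<Rightarrow> real \<Rightarrow> real ^ 4 \<Rightarrow> real" where
  "quad_exponent l1 l2 l3 l4 p =
     l1 * (p $ 1)\<^sup>2 + l2 * (p $ 2)\<^sup>2 + l3 * (p $ 3)\<^sup>2 + l4 * (p $ 4)\<^sup>2"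


section \<open>General rotational surfaces\<close>

text \<open>Intended for open \<open>J\<close>, where \<^const>\<open>deriv\<close> depends only on the values on \<open>J\<close>.\<close>

definition smooth_on :: "real set \<Rightarrow> (real \<Rightarrow> real) \<Rightarrow> bool" where
  "smooth_on J f \<longleftrightarrow> (\<forall>n. \<forall>u\<in>J. (deriv ^^ n) f field_differentiable at u)"

definition gen_rot ::
    "nat \<Rightarrow> real \<Rightarrow> real \<Rightarrow> (real \<Rightarrow> real) \<Rightarrow> (real \<Rightarrow> real) \<Rightarrow> real \<Rightarrow> real \<Rightarrow> real ^ 4" where
  "gen_rot i \<alpha> \<beta> f g u v =
     (if i = 1
      then vector [f u * cos (\<alpha> * v), f u * sin (\<alpha> * v), g u * cosh (\<beta> * v), g u * sinh (\<beta> * v)]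
      else vector [f u * cos (\<alpha> * v), f u * sin (\<alpha> * v), g u * sinh (\<beta> * v), g u * cosh (\<beta> * v)])"

definition meridian :: "nat \<Rightarrow> (real \<Rightarrow> real) \<Rightarrow> (real \<Rightarrow> real) \<Rightarrow> real \<Rightarrow> real ^ 4" where
  "meridian i f g u = (if i = 1 then vector [f u, 0, g u, 0] else vector [f u, 0, 0, g u])"

definition timelike_profile ::
    "nat \<Rightarrow> real \<Rightarrow> real \<Rightarrow> (real \<Rightarrow> real) \<Rightarrow> (real \<Rightarrow> real) \<Rightarrow> real set \<Rightarrow> bool" where
  "timelike_profile i \<alpha> \<beta> f g J \<longleftrightarrow>
     (\<forall>u\<in>J. if i = 1
        then \<alpha>\<^sup>2 * (f u)\<^sup>2 - \<beta>\<^sup>2 * (g u)\<^sup>2 < 0 \<and> (deriv f u)\<^sup>2 + (deriv g u)\<^sup>2 > 0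
        else (deriv f u)\<^sup>2 - (deriv g u)\<^sup>2 < 0 \<and> \<alpha>\<^sup>2 * (f u)\<^sup>2 + \<beta>\<^sup>2 * (g u)\<^sup>2 > 0)"

definition reparametrization ::
    "(real \<Rightarrow> real ^ 4) \<Rightarrow> real set \<Rightarrow> (real \<Rightarrow> real ^ 4) \<Rightarrow> real set \<Rightarrow> bool" where
  "reparametrization c J d I \<longleftrightarrow>
     (\<exists>\<psi>. bij_betw \<psi> J I \<and> smooth_on J \<psi> \<and> (\<forall>u\<in>J. deriv \<psi> u \<noteq> 0) \<and> (\<forall>u\<in>J. c u = d (\<psi> u)))"

definition A3 :: "real \<Rightarrow> real \<Rightarrow> real \<Rightarrow> real \<Rightarrow> (real \<Rightarrow> real) \<Rightarrow> real \<Rightarrow> real" where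
  "A3 \<epsilon> \<alpha> \<beta> \<delta> g u =
     (- 2 * \<delta> * ((\<alpha> * u)\<^sup>2 + \<epsilon> * (\<beta> * g u)\<^sup>2)\<^sup>2 * (- \<epsilon> + (deriv g u)\<^sup>2)
        + \<alpha>\<^sup>2 * \<beta>\<^sup>2 * (g u - u * deriv g u)\<^sup>2)
     / ((\<epsilon> * (\<alpha> * u)\<^sup>2 + (\<beta> * g u)\<^sup>2) * (\<beta>\<^sup>2 * g u + \<alpha>\<^sup>2 * u * deriv g u))"

text \<open>For a timelike surface of the second type with \<open>f u = u\<close> one has \<open>(g')\<^sup>2 > 1\<close>, so the
  argument of the logarithm is negative; hence the absolute value.\<close>

definition flatness_ode ::
    "nat \<Rightarrow> real \<Rightarrow> real \<Rightarrow> real \<Rightarrow> real \<Rightarrow> (real \<Rightarrow> real) \<Rightarrow> real set \<Rightarrow> bool" where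
  "flatness_ode i \<epsilon> \<alpha> \<beta> \<delta> g J \<longleftrightarrow>
     (\<forall>u\<in>J. if i = 1
        then ((\<lambda>s. arctan (deriv g s)) has_real_derivative A3 \<epsilon> \<alpha> \<beta> \<delta> g u) (at u)
        else ((\<lambda>s. ln \<bar>(1 - deriv g s) / (1 + deriv g s)\<bar>)
                has_real_derivative 2 * A3 \<epsilon> \<alpha> \<beta> \<delta> g u) (at u))"


section \<open>Closed formulas for the curvature and the Laplacian\<close>

lemma vector_4 [simp]:
  "(vector [a, b, c, d] :: 'a::zero ^ 4) $ 1 = a"
  "(vector [a, b, c, d] :: 'a ^ 4) $ 2 = b"
  "(vector [a, b, c, d] :: 'a ^ 4) $ 3 = c"
  "(vector [a, b, c, d] :: 'a ^ 4) $ 4 = d"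
  by (simp_all add: vector_def)

lemma mink_vector [simp]:
  "mink (vector [a, b, c, d]) (vector [a', b', c', d']) = a * a' + b * b' + c * c' - d * d'"
  by (simp add: mink_def)

lemma has_vector_derivative_vector_4:
  assumes "(a has_real_derivative a') (at x)" "(b has_real_derivative b') (at x)"
    "(c has_real_derivative c') (at x)" "(d has_real_derivative d') (at x)"
  shows "((\<lambda>s. vector [a s, b s, c s, d s] :: real ^ 4) has_vector_derivative
           vector [a', b', c', d']) (at x)"
proof -
  have eq: "vector [p, q, r, s] =
      p *\<^sub>R (axis 1 1 :: real ^ 4) + q *\<^sub>R axis 2 1 + r *\<^sub>R axis 3 1 + s *\<^sub>R axis 4 1"
    for p q r s :: real
    by (simp add: vec_eq_iff forall_4 axis_def)
  show ?thesis
    unfolding eq using assms by (auto intro!: derivative_eq_intros)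
qed

lemma mink_diff_left: "mink (a - b) c = mink a c - mink b c"
  and mink_diff_right: "mink c (a - b) = mink c a - mink c b"
  and mink_scale_left: "mink (r *\<^sub>R a) c = r * mink a c"
  and mink_scale_right: "mink c (r *\<^sub>R a) = r * mink c a"
  and mink_commute: "mink a c = mink c a"
  by (simp_all add: mink_def algebra_simps)

lemma mink_normal_part_orthogonal:
  assumes "mink p q = 0" "mink p p \<noteq> 0" "mink q q \<noteq> 0"
  shows "mink (normal_part p q a) (normal_part p q b) =
     mink a b - mink a p * mink b p / mink p p - mink a q * mink b q / mink q q"
proof -
  have "mink q p = 0" using assms(1) by (simp add: mink_commute)
  then have "normal_part p q c = c - (mink c p / mink p p) *\<^sub>R p - (mink c q / mink q q) *\<^sub>R q"
    for c using assms by (simp add: normal_part_def gram_det_def)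
  moreover have "mink p b = mink b p" "mink q b = mink b q" by (simp_all add: mink_commute)
  ultimately show ?thesis
    using assms \<open>mink q p = 0\<close>
    by (simp add: mink_diff_left mink_diff_right mink_scale_left mink_scale_right)
qed

lemma gaussian_curvature_orthogonal:
  assumes "surf_du X u v = p" "surf_dv X u v = q"
    and "surf_du (surf_du X) u v = a" "surf_dv (surf_du X) u v = b" "surf_dv (surf_dv X) u v = c"
    and "mink p q = 0" "mink p p \<noteq> 0" "mink q q \<noteq> 0"
  shows "gaussian_curvature X u v =
     ((mink a c - mink a p * mink c p / mink p p - mink a q * mink c q / mink q q)
      - (mink b b - (mink b p)\<^sup>2 / mink p p - (mink b q)\<^sup>2 / mink q q)) / (mink p p * mink q q)"
  using assms
  by (simp add: gaussian_curvature_def Let_def mink_normal_part_orthogonal gram_det_def power2_eq_square)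

lemma smooth_on_deriv:
  assumes "smooth_on J f" "u \<in> J"
  shows "(f has_real_derivative deriv f u) (at u)"
    and "(deriv f has_real_derivative deriv (deriv f) u) (at u)"
proof -
  have "(deriv ^^ 0) f field_differentiable at u" "(deriv ^^ 1) f field_differentiable at u"
    using assms unfolding smooth_on_def by blast+
  then show "(f has_real_derivative deriv f u) (at u)"
    "(deriv f has_real_derivative deriv (deriv f) u) (at u)"
    by (simp_all add: DERIV_deriv_iff_field_differentiable)
qed

lemma surf_duI: "((\<lambda>s. X s v) has_vector_derivative w) (at u) \<Longrightarrow> surf_du X u v = w"
  by (simp add: surf_du_def vector_derivative_at)

lemma surf_dvI: "((\<lambda>s. X u s) has_vector_derivative w) (at v) \<Longrightarrow> surf_dv X u v = w"
  by (simp add: surf_dv_def vector_derivative_at)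

lemma surf_du_transform:
  assumes "open J" "u \<in> J" "\<And>s. s \<in> J \<Longrightarrow> X s v = Y s v"
    and "((\<lambda>s. Y s v) has_vector_derivative w) (at u)"
  shows "surf_du X u v = w"
  using assms
  by (intro surf_duI) (rule has_vector_derivative_transform_within_open [of "\<lambda>s. Y s v"], auto)

lemma gaussian_curvature_gen_rot:
  fixes f g :: "real \<Rightarrow> real" and \<alpha> \<beta> :: real
  assumes i: "i \<in> {1, 2}" and e: "\<epsilon> = (- 1) ^ i"
    and J: "open J" "u \<in> J" and sm: "smooth_on J f" "smooth_on J g"
    and tl: "timelike_profile i \<alpha> \<beta> f g J"
  shows "gaussian_curvature (gen_rot i \<alpha> \<beta> f g) u v =
    (\<alpha>\<^sup>2 * \<beta>\<^sup>2 * (g u * deriv f u - f u * deriv g u)\<^sup>2 * (- \<epsilon> * (deriv f u)\<^sup>2 + (deriv g u)\<^sup>2)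
     + (\<epsilon> * (\<alpha> * f u)\<^sup>2 + (\<beta> * g u)\<^sup>2) * (\<alpha>\<^sup>2 * f u * deriv g u + \<beta>\<^sup>2 * g u * deriv f u)
       * (deriv (deriv f) u * deriv g u - deriv f u * deriv (deriv g) u))
    / (((\<alpha> * f u)\<^sup>2 + \<epsilon> * (\<beta> * g u)\<^sup>2)\<^sup>2 * (- \<epsilon> * (deriv f u)\<^sup>2 + (deriv g u)\<^sup>2)\<^sup>2)"
proof -
  note [simp] = cosh_square_eq
  note df = smooth_on_deriv [OF sm(1)] and dg = smooth_on_deriv [OF sm(2)]
  have sc: "(cos t)\<^sup>2 = 1 - (sin t)\<^sup>2" for t :: real
    by (simp add: cos_squared_eq)
  let ?X = "gen_rot i \<alpha> \<beta> f g"
  let ?f1 = "deriv f u" and ?g1 = "deriv g u" and ?f2 = "deriv (deriv f) u" and ?g2 = "deriv (deriv g) u"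
  from i consider "i = 1" | "i = 2" by auto
  then show ?thesis
  proof cases
    case 1
    have X: "?X = (\<lambda>s w. vector [f s * cos (\<alpha> * w), f s * sin (\<alpha> * w), g s * cosh (\<beta> * w), g s * sinh (\<beta> * w)])"
      by (simp add: gen_rot_def 1 fun_eq_iff)
    have du: "surf_du ?X s w = vector [deriv f s * cos (\<alpha> * w), deriv f s * sin (\<alpha> * w),
        deriv g s * cosh (\<beta> * w), deriv g s * sinh (\<beta> * w)]" if "s \<in> J" for s w
      unfolding X using that
      by (intro surf_duI has_vector_derivative_vector_4) (auto intro!: derivative_eq_intros df dg)
    have dv: "surf_dv ?X s w = vector [- (\<alpha> * f s * sin (\<alpha> * w)), \<alpha> * f s * cos (\<alpha> * w),
        \<beta> * g s * sinh (\<beta> * w), \<beta> * g s * cosh (\<beta> * w)]" for s w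
      unfolding X
      by (intro surf_dvI has_vector_derivative_vector_4) (auto intro!: derivative_eq_intros)
    have duu: "surf_du (surf_du ?X) u v = vector [?f2 * cos (\<alpha> * v), ?f2 * sin (\<alpha> * v),
        ?g2 * cosh (\<beta> * v), ?g2 * sinh (\<beta> * v)]"
      by (rule surf_du_transform [OF J], erule du, rule has_vector_derivative_vector_4)
        (auto intro!: derivative_eq_intros df dg J)
    have duv: "surf_dv (surf_du ?X) u v = vector [- (\<alpha> * ?f1 * sin (\<alpha> * v)), \<alpha> * ?f1 * cos (\<alpha> * v),
        \<beta> * ?g1 * sinh (\<beta> * v), \<beta> * ?g1 * cosh (\<beta> * v)]"
      by (rule surf_dvI, unfold du [OF J(2)], rule has_vector_derivative_vector_4)
        (auto intro!: derivative_eq_intros)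
    have dvv: "surf_dv (surf_dv ?X) u v = vector [- (\<alpha>\<^sup>2 * f u * cos (\<alpha> * v)), - (\<alpha>\<^sup>2 * f u * sin (\<alpha> * v)),
        \<beta>\<^sup>2 * g u * cosh (\<beta> * v), \<beta>\<^sup>2 * g u * sinh (\<beta> * v)]"
      by (rule surf_dvI, unfold dv, rule has_vector_derivative_vector_4)
        (auto intro!: derivative_eq_intros simp: power2_eq_square)
    let ?p = "surf_du ?X u v" and ?q = "surf_dv ?X u v" and ?a = "surf_du (surf_du ?X) u v"
      and ?b = "surf_dv (surf_du ?X) u v" and ?c = "surf_dv (surf_dv ?X) u v"
    define S C s c where "S = sinh (\<beta> * v)" and "C = cosh (\<beta> * v)"
      and "s = sin (\<alpha> * v)" and "c = cos (\<alpha> * v)"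
    have rel: "C\<^sup>2 = S\<^sup>2 + 1" "c\<^sup>2 = 1 - s\<^sup>2"
      by (simp_all add: S_def C_def s_def c_def sc)
    note vals = du [OF J(2), of v] dv [of u v] duu duv dvv
    note vals' = vals [folded S_def C_def s_def c_def]
    have m: "mink ?p ?p = ?f1\<^sup>2 + ?g1\<^sup>2" "mink ?q ?q = \<alpha>\<^sup>2 * (f u)\<^sup>2 - \<beta>\<^sup>2 * (g u)\<^sup>2" "mink ?p ?q = 0"
      "mink ?a ?c = - (\<alpha>\<^sup>2 * f u * ?f2) + \<beta>\<^sup>2 * g u * ?g2" "mink ?b ?b = \<alpha>\<^sup>2 * ?f1\<^sup>2 - \<beta>\<^sup>2 * ?g1\<^sup>2"
      "mink ?a ?p = ?f1 * ?f2 + ?g1 * ?g2" "mink ?a ?q = 0"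
      "mink ?b ?p = 0" "mink ?b ?q = \<alpha>\<^sup>2 * f u * ?f1 - \<beta>\<^sup>2 * g u * ?g1"
      "mink ?c ?p = - (\<alpha>\<^sup>2 * f u * ?f1) + \<beta>\<^sup>2 * g u * ?g1" "mink ?c ?q = 0"
      unfolding vals' mink_vector by (insert rel; (algebra | (simp; fail) | (simp add: algebra_simps; fail)))+
    have nz: "?f1\<^sup>2 + ?g1\<^sup>2 \<noteq> 0" "\<alpha>\<^sup>2 * (f u)\<^sup>2 - \<beta>\<^sup>2 * (g u)\<^sup>2 \<noteq> 0"
      using tl J(2) 1 by (auto simp: timelike_profile_def)
    have K: "gaussian_curvature ?X u v =
      ((- (\<alpha>\<^sup>2 * f u * ?f2) + \<beta>\<^sup>2 * g u * ?g2
         - (?f1 * ?f2 + ?g1 * ?g2) * (- (\<alpha>\<^sup>2 * f u * ?f1) + \<beta>\<^sup>2 * g u * ?g1) / (?f1\<^sup>2 + ?g1\<^sup>2))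
       - (\<alpha>\<^sup>2 * ?f1\<^sup>2 - \<beta>\<^sup>2 * ?g1\<^sup>2
          - (\<alpha>\<^sup>2 * f u * ?f1 - \<beta>\<^sup>2 * g u * ?g1)\<^sup>2 / (\<alpha>\<^sup>2 * (f u)\<^sup>2 - \<beta>\<^sup>2 * (g u)\<^sup>2)))
      / ((?f1\<^sup>2 + ?g1\<^sup>2) * (\<alpha>\<^sup>2 * (f u)\<^sup>2 - \<beta>\<^sup>2 * (g u)\<^sup>2))"
      using gaussian_curvature_orthogonal [OF refl refl refl refl refl, of ?X u v, unfolded m] nz
      by simp
    define E G where "E = ?f1\<^sup>2 + ?g1\<^sup>2" and "G = \<alpha>\<^sup>2 * (f u)\<^sup>2 - \<beta>\<^sup>2 * (g u)\<^sup>2"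
    have den: "(\<alpha> * f u)\<^sup>2 + \<epsilon> * (\<beta> * g u)\<^sup>2 = G" "- \<epsilon> * ?f1\<^sup>2 + ?g1\<^sup>2 = E"
      "\<epsilon> * (\<alpha> * f u)\<^sup>2 + (\<beta> * g u)\<^sup>2 = - G"
      by (simp_all add: E_def G_def e 1 power_mult_distrib)
    have nz': "E \<noteq> 0" "G \<noteq> 0" using nz by (simp_all add: E_def G_def)
    show ?thesis
      unfolding K den E_def [symmetric] G_def [symmetric]
      using nz' apply (simp add: divide_simps)
      using E_def G_def by algebra
  next
    case 2
    have X: "?X = (\<lambda>s w. vector [f s * cos (\<alpha> * w), f s * sin (\<alpha> * w), g s * sinh (\<beta> * w), g s * cosh (\<beta> * w)])"
      by (simp add: gen_rot_def 2 fun_eq_iff)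
    have du: "surf_du ?X s w = vector [deriv f s * cos (\<alpha> * w), deriv f s * sin (\<alpha> * w),
        deriv g s * sinh (\<beta> * w), deriv g s * cosh (\<beta> * w)]" if "s \<in> J" for s w
      unfolding X using that
      by (intro surf_duI has_vector_derivative_vector_4) (auto intro!: derivative_eq_intros df dg)
    have dv: "surf_dv ?X s w = vector [- (\<alpha> * f s * sin (\<alpha> * w)), \<alpha> * f s * cos (\<alpha> * w),
        \<beta> * g s * cosh (\<beta> * w), \<beta> * g s * sinh (\<beta> * w)]" for s w
      unfolding X
      by (intro surf_dvI has_vector_derivative_vector_4) (auto intro!: derivative_eq_intros)
    have duu: "surf_du (surf_du ?X) u v = vector [?f2 * cos (\<alpha> * v), ?f2 * sin (\<alpha> * v),
        ?g2 * sinh (\<beta> * v), ?g2 * cosh (\<beta> * v)]"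
      by (rule surf_du_transform [OF J], erule du, rule has_vector_derivative_vector_4)
        (auto intro!: derivative_eq_intros df dg J)
    have duv: "surf_dv (surf_du ?X) u v = vector [- (\<alpha> * ?f1 * sin (\<alpha> * v)), \<alpha> * ?f1 * cos (\<alpha> * v),
        \<beta> * ?g1 * cosh (\<beta> * v), \<beta> * ?g1 * sinh (\<beta> * v)]"
      by (rule surf_dvI, unfold du [OF J(2)], rule has_vector_derivative_vector_4)
        (auto intro!: derivative_eq_intros)
    have dvv: "surf_dv (surf_dv ?X) u v = vector [- (\<alpha>\<^sup>2 * f u * cos (\<alpha> * v)), - (\<alpha>\<^sup>2 * f u * sin (\<alpha> * v)),
        \<beta>\<^sup>2 * g u * sinh (\<beta> * v), \<beta>\<^sup>2 * g u * cosh (\<beta> * v)]"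
      by (rule surf_dvI, unfold dv, rule has_vector_derivative_vector_4)
        (auto intro!: derivative_eq_intros simp: power2_eq_square)
    let ?p = "surf_du ?X u v" and ?q = "surf_dv ?X u v" and ?a = "surf_du (surf_du ?X) u v"
      and ?b = "surf_dv (surf_du ?X) u v" and ?c = "surf_dv (surf_dv ?X) u v"
    define S C s c where "S = sinh (\<beta> * v)" and "C = cosh (\<beta> * v)"
      and "s = sin (\<alpha> * v)" and "c = cos (\<alpha> * v)"
    have rel: "C\<^sup>2 = S\<^sup>2 + 1" "c\<^sup>2 = 1 - s\<^sup>2"
      by (simp_all add: S_def C_def s_def c_def sc)
    note vals = du [OF J(2), of v] dv [of u v] duu duv dvv
    note vals' = vals [folded S_def C_def s_def c_def]
    have m: "mink ?p ?p = ?f1\<^sup>2 - ?g1\<^sup>2" "mink ?q ?q = \<alpha>\<^sup>2 * (f u)\<^sup>2 + \<beta>\<^sup>2 * (g u)\<^sup>2" "mink ?p ?q = 0"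
      "mink ?a ?c = - (\<alpha>\<^sup>2 * f u * ?f2) - \<beta>\<^sup>2 * g u * ?g2" "mink ?b ?b = \<alpha>\<^sup>2 * ?f1\<^sup>2 + \<beta>\<^sup>2 * ?g1\<^sup>2"
      "mink ?a ?p = ?f1 * ?f2 - ?g1 * ?g2" "mink ?a ?q = 0"
      "mink ?b ?p = 0" "mink ?b ?q = \<alpha>\<^sup>2 * f u * ?f1 + \<beta>\<^sup>2 * g u * ?g1"
      "mink ?c ?p = - (\<alpha>\<^sup>2 * f u * ?f1) - \<beta>\<^sup>2 * g u * ?g1" "mink ?c ?q = 0"
      unfolding vals' mink_vector by (insert rel; (algebra | (simp; fail) | (simp add: algebra_simps; fail)))+
    have nz: "?f1\<^sup>2 - ?g1\<^sup>2 \<noteq> 0" "\<alpha>\<^sup>2 * (f u)\<^sup>2 + \<beta>\<^sup>2 * (g u)\<^sup>2 \<noteq> 0"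
      using tl J(2) 2 by (auto simp: timelike_profile_def)
    have K: "gaussian_curvature ?X u v =
      ((- (\<alpha>\<^sup>2 * f u * ?f2) - \<beta>\<^sup>2 * g u * ?g2
         - (?f1 * ?f2 - ?g1 * ?g2) * (- (\<alpha>\<^sup>2 * f u * ?f1) - \<beta>\<^sup>2 * g u * ?g1) / (?f1\<^sup>2 - ?g1\<^sup>2))
       - (\<alpha>\<^sup>2 * ?f1\<^sup>2 + \<beta>\<^sup>2 * ?g1\<^sup>2
          - (\<alpha>\<^sup>2 * f u * ?f1 + \<beta>\<^sup>2 * g u * ?g1)\<^sup>2 / (\<alpha>\<^sup>2 * (f u)\<^sup>2 + \<beta>\<^sup>2 * (g u)\<^sup>2)))
      / ((?f1\<^sup>2 - ?g1\<^sup>2) * (\<alpha>\<^sup>2 * (f u)\<^sup>2 + \<beta>\<^sup>2 * (g u)\<^sup>2))"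
      using gaussian_curvature_orthogonal [OF refl refl refl refl refl, of ?X u v, unfolded m] nz
      by simp
    define E G where "E = ?f1\<^sup>2 - ?g1\<^sup>2" and "G = \<alpha>\<^sup>2 * (f u)\<^sup>2 + \<beta>\<^sup>2 * (g u)\<^sup>2"
    have den: "(\<alpha> * f u)\<^sup>2 + \<epsilon> * (\<beta> * g u)\<^sup>2 = G" "- \<epsilon> * ?f1\<^sup>2 + ?g1\<^sup>2 = - E"
      "\<epsilon> * (\<alpha> * f u)\<^sup>2 + (\<beta> * g u)\<^sup>2 = G"
      by (simp_all add: E_def G_def e 2 power_mult_distrib)
    have nz': "E \<noteq> 0" "G \<noteq> 0" using nz by (simp_all add: E_def G_def)
    show ?thesis
      unfolding K den E_def [symmetric] G_def [symmetric]
      using nz' apply (simp add: divide_simps)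
      using E_def G_def by algebra
  qed
qed

lemma mink_laplacian_quad_exponent:
  "mink_laplacian (quad_exponent l1 l2 l3 l4) p = 2 * (l1 + l2 + l3 - l4)"
proof -
  have "partial k (\<lambda>p. a * (p $ 1)\<^sup>2 + b * (p $ 2)\<^sup>2 + c * (p $ 3)\<^sup>2 + d * (p $ 4)\<^sup>2) =
      (\<lambda>p. 2 * (if k = 1 then a else if k = 2 then b else if k = 3 then c else d) * p $ k)"
    for k :: 4 and a b c d :: real
    unfolding partial_def fun_eq_iff using exhaust_4 [of k]
    by (auto intro!: DERIV_imp_deriv derivative_eq_intros simp: axis_def)
  moreover have "partial k (\<lambda>p. a * p $ k) p = a" for k :: 4 and a :: real and p
    unfolding partial_def by (auto intro!: DERIV_imp_deriv derivative_eq_intros simp: axis_def)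
  ultimately show ?thesis
    unfolding mink_laplacian_def quad_exponent_def by simp
qed

end

theory Submission
  imports Defs
begin

text \<open>Along a graph \<open>f u = u\<close> the closed formula for the Gaussian curvature contains the second
  derivative of the profile only through the term linear in \<open>g''\<close>, and the weight contributes
  the constant \<open>2 * \<delta>\<close>. The timelike condition makes \<open>D = (\<alpha>u)\<^sup>2 + \<epsilon>(\<beta>g)\<^sup>2\<close> and
  \<open>E = g'\<^sup>2 - \<epsilon>\<close> nonzero, and \<open>\<beta>\<^sup>2 g + \<alpha>\<^sup>2 u g' \<noteq> 0\<close> is exactly what makes the coefficient of \<open>g''\<close>
  nonzero, so the vanishing of the weighted curvature can be solved for \<open>g''\<close>. The result is
  \<open>g'' = A\<^sub>3 E\<close> (lemma \<open>weighted_curvature_zero_iff\<close>). Now \<open>g'' / E\<close> is the derivative of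
  \<open>arctan g'\<close> if \<open>\<epsilon> = -1\<close>, and half the derivative of \<open>ln \<bar>(1 - g') / (1 + g')\<bar>\<close> if
  \<open>\<epsilon> = 1\<close>, which turns this equation into the stated ones (lemma \<open>flatness_ode_iff\<close>).

  The reparametrization adds no freedom: comparing first coordinates in
  \<open>(u, \<dots>) = (\<psi> u, \<dots>)\<close> gives \<open>\<psi> u = u\<close>, so both curves have the same parameter set and the same
  profile there (lemma \<open>reparametrization_graph\<close>). Since that set is open, the profiles share their
  derivatives and hence the differential equation.\<close>

lemma deriv_eq_on_open:
  assumes "open S" "x \<in> S" "\<And>y. y \<in> S \<Longrightarrow> f y = g y"
  shows "deriv f x = deriv g x"
  using assms by (intro deriv_cong_ev refl) (auto simp: eventually_nhds)

text \<open>The left-hand side is the weighted curvature for \<open>w = g''\<close> and \<open>M = \<epsilon> D\<close>. One factor \<open>E\<close>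
  of the denominator cancels against the term free of \<open>w\<close>, which is why the numerator on the right
  is that of \<open>A\<^sub>3\<close>.\<close>

lemma solve_curvature_for_second_derivative:
  fixes T E M P D w \<delta> :: real
  assumes "E \<noteq> 0" "M \<noteq> 0" "P \<noteq> 0" "D \<noteq> 0"
  shows "(T * E - M * P * w) / (D\<^sup>2 * E\<^sup>2) - 2 * \<delta> = 0 \<longleftrightarrow>
    w = (- 2 * \<delta> * D\<^sup>2 * E + T) / (M * P) * E"
proof -
  have "(T * E - M * P * w) / (D\<^sup>2 * E\<^sup>2) - 2 * \<delta> = 0 \<longleftrightarrow>
      T * E - M * P * w = 2 * \<delta> * (D\<^sup>2 * E\<^sup>2)"
    using assms by (simp add: field_simps)
  also have "\<dots> \<longleftrightarrow> w * (M * P) = (- 2 * \<delta> * D\<^sup>2 * E + T) * E"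
    by (auto simp: algebra_simps power2_eq_square)
  also have "\<dots> \<longleftrightarrow> w = (- 2 * \<delta> * D\<^sup>2 * E + T) / (M * P) * E"
    using assms by (simp add: eq_divide_eq)
  finally show ?thesis .
qed

lemma weighted_curvature_zero_iff:
  assumes i: "i \<in> {1, 2}" "\<epsilon> = (- 1) ^ i"
    and J: "open J" "u \<in> J" and sm: "smooth_on J f" "smooth_on J g"
    and tl: "timelike_profile i \<alpha> \<beta> f g J"
    and f: "\<And>u. u \<in> J \<Longrightarrow> f u = u"
    and P: "\<beta>\<^sup>2 * g u + \<alpha>\<^sup>2 * u * deriv g u \<noteq> 0"
  shows "weighted_gaussian_curvature (quad_exponent l1 l2 l3 l4) (gen_rot i \<alpha> \<beta> f g) u v = 0 \<longleftrightarrow>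
    deriv (deriv g) u = A3 \<epsilon> \<alpha> \<beta> (l1 + l2 + l3 - l4) g u * (- \<epsilon> + (deriv g u)\<^sup>2)"
proof -
  have f1: "deriv f s = 1" if "s \<in> J" for s
    using deriv_eq_on_open [OF J(1) that, of f "\<lambda>s. s"] f by simp
  have f2: "deriv (deriv f) u = 0"
    using deriv_eq_on_open [OF J, of "deriv f" "\<lambda>_. 1"] f1 by simp
  let ?E = "- \<epsilon> + (deriv g u)\<^sup>2" and ?D = "(\<alpha> * u)\<^sup>2 + \<epsilon> * (\<beta> * g u)\<^sup>2"
    and ?M = "\<epsilon> * (\<alpha> * u)\<^sup>2 + (\<beta> * g u)\<^sup>2" and ?P = "\<beta>\<^sup>2 * g u + \<alpha>\<^sup>2 * u * deriv g u"
    and ?T = "\<alpha>\<^sup>2 * \<beta>\<^sup>2 * (g u - u * deriv g u)\<^sup>2"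
  have nz: "?E \<noteq> 0" "?D \<noteq> 0" "?M \<noteq> 0"
    using i J tl f [OF J(2)] f1 [OF J(2)]
    by (auto simp: timelike_profile_def power_mult_distrib dest!: bspec)
  have "gaussian_curvature (gen_rot i \<alpha> \<beta> f g) u v = (?T * ?E - ?M * ?P * deriv (deriv g) u) / (?D\<^sup>2 * ?E\<^sup>2)"
    unfolding gaussian_curvature_gen_rot [OF i J sm tl] f [OF J(2)] f1 [OF J(2)] f2
    by (simp add: algebra_simps)
  then show ?thesis
    unfolding weighted_gaussian_curvature_def mink_laplacian_quad_exponent A3_def
    by (simp only: solve_curvature_for_second_derivative [OF nz(1,3) P nz(2)])
qed

lemma DERIV_ln_abs_quotient:
  fixes p :: "real \<Rightarrow> real"
  assumes p: "(p has_real_derivative w) (at u)" and nz: "(p u)\<^sup>2 \<noteq> 1"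
  shows "((\<lambda>s. ln \<bar>(1 - p s) / (1 + p s)\<bar>) has_real_derivative 2 * (w / ((p u)\<^sup>2 - 1))) (at u)"
proof -
  define q where "q s = (1 - p s) / (1 + p s)" for s
  have ne: "1 + p u \<noteq> 0" "1 - p u \<noteq> 0" "(p u)\<^sup>2 - 1 \<noteq> 0"
    using nz by (auto simp: power2_eq_1_iff)
  have q: "(q has_real_derivative - 2 * w / (1 + p u)\<^sup>2) (at u)"
    unfolding q_def using p ne
    by (auto intro!: derivative_eq_intros simp: power2_eq_square field_simps)
  have "q u \<noteq> 0" using ne by (simp add: q_def)
  have abs_eq: "(\<lambda>x::real. ln \<bar>x\<bar>) = (\<lambda>x. ln (x\<^sup>2) / 2)"
    using ln_realpow [of "\<bar>_\<bar>" 2] by (auto simp: fun_eq_iff)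
  have "((\<lambda>x. ln \<bar>x\<bar>) has_real_derivative 1 / q u) (at (q u))"
    unfolding abs_eq using \<open>q u \<noteq> 0\<close> zero_less_power2 [of "q u"]
    by (auto intro!: derivative_eq_intros simp: power2_eq_square)
  from DERIV_chain2 [OF this q]
  have "((\<lambda>s. ln \<bar>q s\<bar>) has_real_derivative 1 / q u * (- 2 * w / (1 + p u)\<^sup>2)) (at u)" .
  moreover have "1 / q u * (- 2 * w / (1 + p u)\<^sup>2) = 2 * (w / ((p u)\<^sup>2 - 1))"
  proof -
    have "(p u)\<^sup>2 - 1 = - ((1 - p u) * (1 + p u))"
      by (simp add: algebra_simps power2_eq_square)
    then show ?thesis
      using ne by (simp add: q_def power2_eq_square)
  qed
  ultimately show ?thesis by (simp add: q_def)
qed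

text \<open>The left-hand sides of the differential equations always have the derivative
  \<open>g'' / E\<close>, respectively \<open>2 g'' / E\<close>; by uniqueness of derivatives, requiring them to be
  \<open>A\<^sub>3\<close>, respectively \<open>2 A\<^sub>3\<close>, is the pointwise equation \<open>g'' = A\<^sub>3 E\<close>.\<close>

lemma flatness_ode_iff:
  assumes i: "i \<in> {1, 2}" "\<epsilon> = (- 1) ^ i" and sm: "smooth_on J g"
    and E: "\<And>u. u \<in> J \<Longrightarrow> - \<epsilon> + (deriv g u)\<^sup>2 \<noteq> 0"
  shows "flatness_ode i \<epsilon> \<alpha> \<beta> \<delta> g J \<longleftrightarrow>
    (\<forall>u\<in>J. deriv (deriv g) u = A3 \<epsilon> \<alpha> \<beta> \<delta> g u * (- \<epsilon> + (deriv g u)\<^sup>2))"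
  unfolding flatness_ode_def
proof (rule ball_cong [OF refl])
  fix u assume u: "u \<in> J"
  let ?a = "A3 \<epsilon> \<alpha> \<beta> \<delta> g u" and ?w = "deriv (deriv g) u" and ?E = "- \<epsilon> + (deriv g u)\<^sup>2"
  note dg = smooth_on_deriv(2) [OF sm u]
  have solve: "?w / ?E = ?a \<longleftrightarrow> ?w = ?a * ?E"
    using E [OF u] by (simp add: divide_eq_eq)
  show "(if i = 1
      then ((\<lambda>s. arctan (deriv g s)) has_real_derivative ?a) (at u)
      else ((\<lambda>s. ln \<bar>(1 - deriv g s) / (1 + deriv g s)\<bar>) has_real_derivative 2 * ?a) (at u))
    \<longleftrightarrow> ?w = ?a * ?E"
  proof (cases "i = 1")
    case True
    have "((\<lambda>s. arctan (deriv g s)) has_real_derivative ?w / ?E) (at u)"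
      using dg True i(2) by (auto intro!: derivative_eq_intros simp: divide_inverse)
    then have "((\<lambda>s. arctan (deriv g s)) has_real_derivative ?a) (at u) \<longleftrightarrow> ?w / ?E = ?a"
      by (metis DERIV_unique)
    then show ?thesis using True solve by simp
  next
    case False
    then have e: "\<epsilon> = 1" using i by simp
    have "((\<lambda>s. ln \<bar>(1 - deriv g s) / (1 + deriv g s)\<bar>) has_real_derivative 2 * (?w / ?E)) (at u)"
      using DERIV_ln_abs_quotient [OF dg] E [OF u] e by simp
    then have "((\<lambda>s. ln \<bar>(1 - deriv g s) / (1 + deriv g s)\<bar>) has_real_derivative 2 * ?a) (at u)
        \<longleftrightarrow> 2 * (?w / ?E) = 2 * ?a"
      by (metis DERIV_unique)
    also have "\<dots> \<longleftrightarrow> ?w / ?E = ?a" by linarith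
    finally show ?thesis using False solve by simp
  qed
qed

lemma timelike_graph_nondegenerate:
  assumes "i \<in> {1, 2}" "\<epsilon> = (- 1) ^ i" "open J" "timelike_profile i \<alpha> \<beta> f g J"
    and f: "\<And>u. u \<in> J \<Longrightarrow> f u = u" and u: "u \<in> J"
  shows "- \<epsilon> + (deriv g u)\<^sup>2 \<noteq> 0"
proof -
  have "deriv f u = 1"
    using deriv_eq_on_open [OF assms(3) u, of f "\<lambda>s. s"] f by simp
  then show ?thesis
    using assms by (auto simp: timelike_profile_def dest!: bspec)
qed

lemma flatness_ode_cong:
  assumes "open J" and eq: "\<And>u. u \<in> J \<Longrightarrow> h u = g u"
    and ode: "flatness_ode i \<epsilon> \<alpha> \<beta> \<delta> h J"
  shows "flatness_ode i \<epsilon> \<alpha> \<beta> \<delta> g J"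
  unfolding flatness_ode_def
proof
  fix u assume u: "u \<in> J"
  have d: "deriv h s = deriv g s" if "s \<in> J" for s
    using deriv_eq_on_open [OF \<open>open J\<close> that eq] .
  have A: "A3 \<epsilon> \<alpha> \<beta> \<delta> h u = A3 \<epsilon> \<alpha> \<beta> \<delta> g u"
    by (simp add: A3_def d eq u)
  have *: "((\<lambda>s. F (deriv g s)) has_real_derivative y) (at u)"
    if "((\<lambda>s. F (deriv h s)) has_real_derivative y) (at u)" for F :: "real \<Rightarrow> real" and y
    using that \<open>open J\<close> u by (rule has_field_derivative_transform_within_open) (simp add: d)
  show "if i = 1
    then ((\<lambda>s. arctan (deriv g s)) has_real_derivative A3 \<epsilon> \<alpha> \<beta> \<delta> g u) (at u)
    else ((\<lambda>s. ln \<bar>(1 - deriv g s) / (1 + deriv g s)\<bar>) has_real_derivative 2 * A3 \<epsilon> \<alpha> \<beta> \<delta> g u) (at u)"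
    using ode u * [of arctan] * [of "\<lambda>x. ln \<bar>(1 - x) / (1 + x)\<bar>"]
    by (auto simp: flatness_ode_def A split: if_splits)
qed

text \<open>A graph is parametrized by its own first coordinate, so a change of parameter between two
  graphs is the identity.\<close>

lemma reparametrization_graph:
  assumes "reparametrization (meridian i f g) J (meridian i (\<lambda>u. u) h) I"
    and f: "\<And>u. u \<in> J \<Longrightarrow> f u = u"
  shows "I = J" "\<And>u. u \<in> J \<Longrightarrow> h u = g u"
proof -
  obtain \<psi> where \<psi>: "bij_betw \<psi> J I"
    and c: "\<And>u. u \<in> J \<Longrightarrow> meridian i f g u = meridian i (\<lambda>u. u) h (\<psi> u)"
    using assms(1) unfolding reparametrization_def by blast
  have *: "\<psi> u = u \<and> h u = g u" if "u \<in> J" for u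
    using c [OF that] f [OF that] by (auto simp: meridian_def vec_eq_iff forall_4 split: if_splits)
  then show "\<And>u. u \<in> J \<Longrightarrow> h u = g u" by blast
  have "\<psi> ` J = J" using * by force
  with \<psi> show "I = J" by (simp add: bij_betw_def)
qed

lemma reparametrization_self:
  assumes "open J" "smooth_on J f" and f: "\<And>u. u \<in> J \<Longrightarrow> f u = u"
  shows "reparametrization (meridian i f g) J (meridian i (\<lambda>u. u) g) J"
  unfolding reparametrization_def
proof (intro exI [of _ f] conjI ballI)
  show "bij_betw f J J"
    using f by (simp add: bij_betw_def inj_on_def)
  show "deriv f u \<noteq> 0" if "u \<in> J" for u
    using deriv_eq_on_open [OF assms(1) that, of f "\<lambda>s. s"] f by simp
  show "meridian i f g u = meridian i (\<lambda>u. u) g (f u)" if "u \<in> J" for u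
    using f [OF that] by (simp add: meridian_def)
qed (fact assms)

theorem theorem9:
  fixes i :: nat and \<epsilon> \<alpha> \<beta> l1 l2 l3 l4 \<delta> :: real and f g :: "real \<Rightarrow> real" and J :: "real set"
  assumes "i \<in> {1, 2}" and "\<epsilon> = (- 1) ^ i"
    and "\<alpha> > 0" and "\<beta> > 0"
    and "\<not> (l1 = 0 \<and> l2 = 0 \<and> l3 = 0 \<and> l4 = 0)"
    and "\<delta> = l1 + l2 + l3 - l4"
    and "open J" and "smooth_on J f" and "smooth_on J g"
    and "timelike_profile i \<alpha> \<beta> f g J"
    and "\<And>u. u \<in> J \<Longrightarrow> f u = u"
    and "\<And>u. u \<in> J \<Longrightarrow> \<beta>\<^sup>2 * g u + \<alpha>\<^sup>2 * u * deriv g u \<noteq> 0"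
  shows "weighted_flat (quad_exponent l1 l2 l3 l4) (gen_rot i \<alpha> \<beta> f g) J \<longleftrightarrow>
    (\<exists>I h. open I \<and> smooth_on I h \<and>
       reparametrization (meridian i f g) J (meridian i (\<lambda>u. u) h) I \<and>
       flatness_ode i \<epsilon> \<alpha> \<beta> \<delta> h I)"
proof -
  have "weighted_flat (quad_exponent l1 l2 l3 l4) (gen_rot i \<alpha> \<beta> f g) J \<longleftrightarrow>
      (\<forall>u\<in>J. \<forall>v\<in>{0..<2 * pi}. deriv (deriv g) u = A3 \<epsilon> \<alpha> \<beta> \<delta> g u * (- \<epsilon> + (deriv g u)\<^sup>2))"
    unfolding weighted_flat_def \<open>\<delta> = l1 + l2 + l3 - l4\<close>
    using weighted_curvature_zero_iff [OF assms(1,2,7) _ assms(8-11) assms(12)] by (intro ball_cong refl) blast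
  also have "\<dots> \<longleftrightarrow> (\<forall>u\<in>J. deriv (deriv g) u = A3 \<epsilon> \<alpha> \<beta> \<delta> g u * (- \<epsilon> + (deriv g u)\<^sup>2))"
    using pi_gt_zero by (auto dest!: bspec [of "{0..<2 * pi}" _ 0])
  also have "\<dots> \<longleftrightarrow> flatness_ode i \<epsilon> \<alpha> \<beta> \<delta> g J"
    using flatness_ode_iff [OF assms(1,2,9)] timelike_graph_nondegenerate [OF assms(1,2,7,10,11)]
    by blast
  also have "\<dots> \<longleftrightarrow> (\<exists>I h. open I \<and> smooth_on I h \<and>
      reparametrization (meridian i f g) J (meridian i (\<lambda>u. u) h) I \<and> flatness_ode i \<epsilon> \<alpha> \<beta> \<delta> h I)"
  proof
    assume "flatness_ode i \<epsilon> \<alpha> \<beta> \<delta> g J"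
    then show "\<exists>I h. open I \<and> smooth_on I h \<and>
        reparametrization (meridian i f g) J (meridian i (\<lambda>u. u) h) I \<and> flatness_ode i \<epsilon> \<alpha> \<beta> \<delta> h I"
      using assms(7,9) reparametrization_self [OF assms(7,8,11)] by blast
  next
    assume "\<exists>I h. open I \<and> smooth_on I h \<and>
        reparametrization (meridian i f g) J (meridian i (\<lambda>u. u) h) I \<and> flatness_ode i \<epsilon> \<alpha> \<beta> \<delta> h I"
    then obtain I h where r: "reparametrization (meridian i f g) J (meridian i (\<lambda>u. u) h) I"
      and ode: "flatness_ode i \<epsilon> \<alpha> \<beta> \<delta> h I" by blast
    from reparametrization_graph [OF r assms(11)] ode
    show "flatness_ode i \<epsilon> \<alpha> \<beta> \<delta> g J"
      using flatness_ode_cong [OF assms(7)] by blast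
  qed
  finally show ?thesis .
qed

end
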